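(* Let $S$ be a $\mathrm{Cu}$-semigroup satisfying (O5). Let $u\in S$ be a full compact element, and let $K\subseteq F_u(S)$ be a closed convex subset. Let $M\in(0,\infty)$. Suppose that for all $x,y\in S$ with $y$ full and with $\widehat x|_K\le\widehat y|_K$, we have $\widehat x\le M\widehat y$ (on all of $F(S)$). Then $K=F_u(S)$.
   Context: A $\mathrm{Cu}$-semigroup is a commutative, partially ordered monoid $S$ (order compatible with addition) with $0\le x$ for all $x$, such that: (O1) every increasing sequence has a supremum; (O2) every $x\in S$ is the supremum of a sequence $(x_n)_n$ with $x_n\ll x_{n+1}$ for all $n$; (O3) $x_1\ll x_2$ and $y_1\ll y_2$ imply $x_1+y_1\ll x_2+y_2$; (O4) $\sup_n(x_n+y_n)=\sup_nx_n+\sup_ny_n$ for increasing sequences. Here $x\ll y$ means: for every increasing sequence $(y_n)_n$ with $y\le\sup_ny_n$ there is $n$ with $x\le y_n$. An element $u$ is compact if $u\ll u$. (O5): for all $x'\ll x\le y$ there is $z$ with $x'+z\le y\le x+z$; moreover, if $x+w\le y$ and $w'\ll w$, then $z$ may be chosen with $w'\ll z$. An ideal of $S$ is a downward-hereditary submonoid closed under suprema of increasing sequences. An element $y\in S$ is full if the ideal it generates is $S$ (equivalently, $\sup_n ny$ is the largest element of $S$, when $S$ has one; in particular this is the case for the full element $u$). A functional on $S$ is an order-preserving monoid homomorphism $\lambda\colon S\to[0,\infty]$ preserving suprema of increasing sequences. $F(S)$ is the set of functionals, with pointwise addition and pointwise multiplication by scalars in $(0,\infty)$, endowed with the compact Hausdorff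 topology in which a net $\lambda_j\to\lambda$ iff $\limsup_j\lambda_j(x')\le\lambda(x)\le\liminf_j\lambda_j(x)$ for all $x'\ll x$ in $S$. For $x\in S$, $\widehat x\colon F(S)\to[0,\infty]$ is $\widehat x(\lambda)=\lambda(x)$. $F_u(S)=\{\lambda\in F(S):\lambda(u)=1\}$, with the subspace topology. *)

theory Defs
  imports "HOL-Analysis.Analysis"
begin

definition (in order) seq_sup :: "(nat \<Rightarrow> 'a) \<Rightarrow> 'a \<Rightarrow> bool" where
  "seq_sup s l \<longleftrightarrow> (\<forall>n. s n \<le> l) \<and> (\<forall>b. (\<forall>n. s n \<le> b) \<longrightarrow> l \<le> b)"

definition (in order) way_below :: "'a \<Rightarrow> 'a \<Rightarrow> bool" (infix "\<lless>" 50) where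
  "x \<lless> y \<longleftrightarrow>
     (\<forall>s l. monotone (\<le>) (\<le>) s \<longrightarrow> seq_sup s l \<longrightarrow> y \<le> l \<longrightarrow> (\<exists>n. x \<le> s n))"

definition (in order) compact_element :: "'a \<Rightarrow> bool" where
  "compact_element u \<longleftrightarrow> u \<lless> u"

class cu_semigroup = ordered_comm_monoid_add +
  assumes cu_zero_le: "0 \<le> x"
    and cu_O1: "monotone (\<le>) (\<le>) s \<Longrightarrow> \<exists>l. seq_sup s l"
    and cu_O2: "\<exists>s. (\<forall>n. s n \<lless> s (Suc n)) \<and> seq_sup s x"
    and cu_O3: "x1 \<lless> x2 \<Longrightarrow> y1 \<lless> y2 \<Longrightarrow> x1 + y1 \<lless> x2 + y2"
    and cu_O4: "monotone (\<le>) (\<le>) s \<Longrightarrow> monotone (\<le>) (\<le>) t \<Longrightarrow> seq_sup s a \<Longrightarrow> seq_sup t b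
                  \<Longrightarrow> seq_sup (\<lambda>n. s n + t n) (a + b)"

class cu_semigroup_O5 = cu_semigroup +
  assumes cu_O5: "x' \<lless> x \<Longrightarrow> x \<le> y \<Longrightarrow> \<exists>z. x' + z \<le> y \<and> y \<le> x + z"
    and cu_O5_strong: "x' \<lless> x \<Longrightarrow> x \<le> y \<Longrightarrow> x + w \<le> y \<Longrightarrow> w' \<lless> w
                  \<Longrightarrow> \<exists>z. x' + z \<le> y \<and> y \<le> x + z \<and> w' \<lless> z"

definition cu_ideal :: "'a::cu_semigroup set \<Rightarrow> bool" where
  "cu_ideal I \<longleftrightarrow> 0 \<in> I \<and> (\<forall>x\<in>I. \<forall>y\<in>I. x + y \<in> I) \<and> (\<forall>y\<in>I. \<forall>x. x \<le> y \<longrightarrow> x \<in> I)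
     \<and> (\<forall>s l. incseq s \<longrightarrow> (\<forall>n. s n \<in> I) \<longrightarrow> seq_sup s l \<longrightarrow> l \<in> I)"

definition full_element :: "'a::cu_semigroup \<Rightarrow> bool" where
  "full_element y \<longleftrightarrow> cu_ideal hull {y} = UNIV"

definition functionals :: "('a::cu_semigroup \<Rightarrow> ennreal) set" where
  "functionals = {\<phi>. mono \<phi> \<and> \<phi> 0 = 0 \<and> (\<forall>x y. \<phi> (x + y) = \<phi> x + \<phi> y)
     \<and> (\<forall>s l. incseq s \<longrightarrow> seq_sup s l \<longrightarrow> \<phi> l = (SUP n. \<phi> (s n)))}"

text \<open>Nets are modelled by a family \<open>f\<close> together with a filter on its index type.\<close>

definition functionals_converge ::
  "('i \<Rightarrow> 'a::cu_semigroup \<Rightarrow> ennreal) \<Rightarrow> ('a \<Rightarrow> ennreal) \<Rightarrow> 'i filter \<Rightarrow> bool" where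
  "functionals_converge f \<phi> F \<longleftrightarrow> \<phi> \<in> functionals \<and> (\<forall>\<^sub>F j in F. f j \<in> functionals)
     \<and> (\<forall>x' x. x' \<lless> x \<longrightarrow> Limsup F (\<lambda>j. f j x') \<le> \<phi> x \<and> \<phi> x \<le> Liminf F (\<lambda>j. f j x))"

text \<open>A set is open iff every net converging to one of its points is eventually inside it; the
  index filter may be taken on the function space itself. Lemma \<open>limitin_functional_topology\<close>
  below shows that the convergent nets of this topology are exactly the prescribed ones, which
  determines the topology.\<close>

definition functional_topology :: "('a::cu_semigroup \<Rightarrow> ennreal) topology" where
  "functional_topology = topology (\<lambda>U. U \<subseteq> functionals \<and>
     (\<forall>\<phi>\<in>U. \<forall>F. functionals_converge (\<lambda>\<mu>. \<mu>) \<phi> F \<longrightarrow> (\<forall>\<^sub>F \<mu> in F. \<mu> \<in> U)))"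

definition normalized_functionals :: "'a::cu_semigroup \<Rightarrow> ('a \<Rightarrow> ennreal) set" where
  "normalized_functionals u = {\<phi> \<in> functionals. \<phi> u = 1}"

definition hat :: "'a \<Rightarrow> ('a \<Rightarrow> ennreal) \<Rightarrow> ennreal" where
  "hat x \<phi> = \<phi> x"

text \<open>The function space is a cone rather than a real vector space, so the library's
  \<open>convex\<close> does not apply. Scalars are strictly positive.\<close>

definition convex_functionals :: "('a \<Rightarrow> ennreal) set \<Rightarrow> bool" where
  "convex_functionals K \<longleftrightarrow> (\<forall>\<phi>\<in>K. \<forall>\<mu>\<in>K. \<forall>s t::real. 0 < s \<longrightarrow> 0 < t \<longrightarrow> s + t = 1 \<longrightarrow>
     (\<lambda>x. ennreal s * \<phi> x + ennreal t * \<mu> x) \<in> K)"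

lemma openin_functional_topology:
  "openin functional_topology U \<longleftrightarrow> U \<subseteq> functionals \<and>
     (\<forall>\<phi>\<in>U. \<forall>F. functionals_converge (\<lambda>\<mu>. \<mu>) \<phi> F \<longrightarrow> (\<forall>\<^sub>F \<mu> in F. \<mu> \<in> U))"
proof -
  have "istopology (\<lambda>U. U \<subseteq> (functionals :: ('a::cu_semigroup \<Rightarrow> ennreal) set) \<and>
     (\<forall>\<phi>\<in>U. \<forall>F. functionals_converge (\<lambda>\<mu>. \<mu>) \<phi> F \<longrightarrow> (\<forall>\<^sub>F \<mu> in F. \<mu> \<in> U)))"
    unfolding istopology_def
  proof (intro conjI allI impI ballI; (elim conjE)?)
    fix \<U> :: "('a \<Rightarrow> ennreal) set set" and \<phi> F
    assume *: "\<forall>K\<in>\<U>. K \<subseteq> functionals \<and>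
        (\<forall>\<phi>\<in>K. \<forall>F. functionals_converge (\<lambda>\<mu>. \<mu>) \<phi> F \<longrightarrow> (\<forall>\<^sub>F \<mu> in F. \<mu> \<in> K))"
      and "\<phi> \<in> \<Union>\<U>" and conv: "functionals_converge (\<lambda>\<mu>. \<mu>) \<phi> F"
    then obtain U where U: "U \<in> \<U>" "\<phi> \<in> U" by blast
    with * conv have "\<forall>\<^sub>F \<mu> in F. \<mu> \<in> U" by blast
    then show "\<forall>\<^sub>F \<mu> in F. \<mu> \<in> \<Union>\<U>" by eventually_elim (use U in blast)
  qed (auto simp: eventually_conj_iff)
  then show ?thesis unfolding functional_topology_def by (simp add: topology_inverse')
qed

lemma topspace_functional_topology: "topspace functional_topology = functionals"
proof -
  have "openin functional_topology (functionals :: ('a \<Rightarrow> ennreal) set)"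
    by (auto simp: openin_functional_topology functionals_converge_def)
  then show ?thesis
    unfolding topspace_def using openin_functional_topology by blast
qed

lemma way_below_le: "x \<lless> y \<Longrightarrow> x \<le> y"
proof -
  assume "x \<lless> y"
  moreover have "incseq (\<lambda>n::nat. y)" "seq_sup (\<lambda>n. y) y"
    by (auto simp: monotone_def seq_sup_def)
  ultimately show ?thesis unfolding way_below_def by blast
qed

lemma le_way_below_trans: "x \<le> y \<Longrightarrow> y \<lless> z \<Longrightarrow> x \<lless> z"
  unfolding way_below_def by (meson order_trans)

lemma way_below_le_trans: "x \<lless> y \<Longrightarrow> y \<le> z \<Longrightarrow> x \<lless> z"
  unfolding way_below_def by (meson order_trans)

lemma way_below_interpolate:
  fixes x y :: "'a::cu_semigroup"
  assumes "x \<lless> y"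
  obtains z where "x \<lless> z" "z \<lless> y"
proof -
  obtain s where s: "\<And>n. s n \<lless> s (Suc n)" "seq_sup s y" using cu_O2[of y] by blast
  have "incseq s" by (rule incseq_SucI) (use s way_below_le in blast)
  with assms s obtain n where "x \<le> s n" unfolding way_below_def by blast
  moreover have "s (Suc (Suc n)) \<le> y" using s by (auto simp: seq_sup_def)
  ultimately show ?thesis
    using that s le_way_below_trans way_below_le_trans by blast
qed

lemma openin_functional_greater:
  "openin functional_topology {\<mu> \<in> functionals. t < \<mu> x}"
  unfolding openin_functional_topology
proof safe
  fix \<phi> :: "'a \<Rightarrow> ennreal" and F
  assume \<phi>: "\<phi> \<in> functionals" "t < \<phi> x" and conv: "functionals_converge (\<lambda>\<mu>. \<mu>) \<phi> F"
  obtain s where s: "\<And>n. s n \<lless> s (Suc n)" "seq_sup s x" using cu_O2[of x] by blast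
  have "incseq s" by (rule incseq_SucI) (use s way_below_le in blast)
  with s \<phi> have "t < (SUP n. \<phi> (s n))" unfolding functionals_def by auto
  then obtain n where n: "t < \<phi> (s n)" by (auto simp: less_SUP_iff)
  have "\<phi> (s (Suc n)) \<le> Liminf F (\<lambda>\<mu>. \<mu> (s (Suc n)))"
    using conv s(1)[of "Suc n"] s(1)[of n] unfolding functionals_converge_def by blast
  moreover have "\<phi> (s n) \<le> \<phi> (s (Suc n))"
    using \<phi> s way_below_le unfolding functionals_def by (auto dest: monoD)
  ultimately have "t < Liminf F (\<lambda>\<mu>. \<mu> (s (Suc n)))" using n by (meson order_less_le_trans)
  then have "\<forall>\<^sub>F \<mu> in F. t < \<mu> (s (Suc n))" by (rule less_LiminfD)
  moreover have "\<forall>\<^sub>F \<mu> in F. \<mu> \<in> functionals" using conv by (simp add: functionals_converge_def)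
  ultimately show "\<forall>\<^sub>F \<mu> in F. \<mu> \<in> {\<mu> \<in> functionals. t < \<mu> x}"
  proof eventually_elim
    case (elim \<mu>)
    have "s (Suc n) \<le> x" using s by (auto simp: seq_sup_def)
    with elim show ?case unfolding functionals_def by (auto dest: monoD order_less_le_trans)
  qed
qed

lemma openin_functional_less:
  "openin functional_topology {\<mu> \<in> functionals. \<exists>y. x \<lless> y \<and> \<mu> y < t}"
  unfolding openin_functional_topology
proof safe
  fix \<phi> :: "'a \<Rightarrow> ennreal" and F y
  assume \<phi>: "\<phi> \<in> functionals" "x \<lless> y" "\<phi> y < t" and conv: "functionals_converge (\<lambda>\<mu>. \<mu>) \<phi> F"
  obtain z where z: "x \<lless> z" "z \<lless> y" using \<phi>(2) by (rule way_below_interpolate)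
  have "Limsup F (\<lambda>\<mu>. \<mu> z) < t"
    using conv z \<phi> unfolding functionals_converge_def by (meson order_le_less_trans)
  then have "\<forall>\<^sub>F \<mu> in F. \<mu> z < t" by (rule Limsup_lessD)
  moreover have "\<forall>\<^sub>F \<mu> in F. \<mu> \<in> functionals" using conv by (simp add: functionals_converge_def)
  ultimately show "\<forall>\<^sub>F \<mu> in F. \<mu> \<in> {\<mu> \<in> functionals. \<exists>y. x \<lless> y \<and> \<mu> y < t}"
    by eventually_elim (use z in blast)
qed

lemma limitin_functional_topology:
  "limitin functional_topology f \<phi> F \<longleftrightarrow> functionals_converge f \<phi> F"
proof
  assume conv: "functionals_converge f \<phi> F"
  then have conv': "functionals_converge (\<lambda>\<mu>. \<mu>) \<phi> (filtermap f F)"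
    unfolding functionals_converge_def le_Liminf_iff Limsup_le_iff
    by (simp add: eventually_filtermap)
  have "\<forall>\<^sub>F j in F. f j \<in> U" if "openin functional_topology U" "\<phi> \<in> U" for U
  proof -
    have "\<forall>\<^sub>F \<mu> in filtermap f F. \<mu> \<in> U"
      using that conv' unfolding openin_functional_topology by blast
    then show ?thesis by (simp add: eventually_filtermap)
  qed
  then show "limitin functional_topology f \<phi> F"
    using conv
    by (simp add: limitin_def topspace_functional_topology functionals_converge_def)
next
  assume lim: "limitin functional_topology f \<phi> F"
  have \<phi>: "\<phi> \<in> functionals"
    using lim by (simp add: limitin_def topspace_functional_topology)
  have ev: "\<forall>\<^sub>F j in F. f j \<in> U" if "openin functional_topology U" "\<phi> \<in> U" for U
    using lim that by (simp add: limitin_def)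
  have "\<forall>\<^sub>F j in F. f j \<in> functionals"
    using ev[of functionals] \<phi> openin_topspace[of functional_topology]
    by (simp add: topspace_functional_topology)
  moreover have "\<phi> x \<le> Liminf F (\<lambda>j. f j x)" for x
    unfolding le_Liminf_iff
  proof (intro allI impI)
    fix t assume "t < \<phi> x"
    with ev[OF openin_functional_greater, of t x] \<phi>
    show "\<forall>\<^sub>F j in F. t < f j x" by (auto elim: eventually_mono)
  qed
  moreover have "Limsup F (\<lambda>j. f j x') \<le> \<phi> x" if "x' \<lless> x" for x' x
    unfolding Limsup_le_iff
  proof (intro allI impI)
    fix t assume "\<phi> x < t"
    with ev[OF openin_functional_less, of x' t] \<phi> that
    have "\<forall>\<^sub>F j in F. f j \<in> functionals \<and> (\<exists>y. x' \<lless> y \<and> f j y < t)" by auto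
    then show "\<forall>\<^sub>F j in F. f j x' < t"
    proof eventually_elim
      case (elim j)
      then obtain y where y: "x' \<le> y" "f j y < t" "mono (f j)"
        using way_below_le by (auto simp: functionals_def)
      then show ?case using monoD order_le_less_trans by metis
    qed
  qed
  ultimately show "functionals_converge f \<phi> F"
    using \<phi> by (simp add: functionals_converge_def)
qed

end

theory Submission
  imports Defs
begin

text \<open>Write \<open>F\<^sub>u\<close> for the normalized functionals. Every \<open>\<phi> \<in> F\<^sub>u\<close> dominates \<open>\<kappa> / M\<close> for some
  \<open>\<kappa> \<in> K\<close>. By compactness it suffices to find \<open>\<kappa>\<close> with \<open>\<kappa> \<le> M \<phi> + \<epsilon>\<close> on a finite set of elements;
  if there were none, a finite minimax argument (this uses convexity of \<open>K\<close>) would give a full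
  element \<open>y\<close>, a sum of multiples of these elements and \<open>u\<close>, and a number \<open>p\<close> with
  \<open>\<kappa> y \<ge> p = \<kappa> (p u)\<close> for all \<open>\<kappa> \<in> K\<close> but \<open>\<phi> (p u) = p > M \<phi> y\<close>, against the comparison hypothesis.

  Enlarging \<open>M\<close>, put \<open>\<theta> = 1 / M < 1\<close>. By (O5) the difference \<open>\<phi> - \<theta> \<kappa>\<close> is, up to regularization, a
  functional, so \<open>\<phi> \<ge> \<theta> \<kappa> + (1 - \<theta>) \<phi>'\<close> with \<open>\<phi>' \<in> F\<^sub>u\<close>, and the same applies to \<open>\<phi>'\<close>. Iterating,
  \<open>\<phi>\<close> dominates \<open>(1 - (1 - \<theta>)\<^sup>n) \<kappa>\<^sub>n\<close> with \<open>\<kappa>\<^sub>n \<in> K\<close> for every \<open>n\<close>. By compactness again, \<open>\<phi>\<close> dominates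
  an element of \<open>K\<close>, and it is equal to it since both are normalized.\<close>

subsection \<open>Functionals and regularization\<close>

lemma functionalsD:
  assumes "\<phi> \<in> functionals"
  shows "x \<le> y \<Longrightarrow> \<phi> x \<le> \<phi> y" "\<phi> 0 = 0" "\<phi> (x + y) = \<phi> x + \<phi> y"
    "incseq s \<Longrightarrow> seq_sup s l \<Longrightarrow> \<phi> l = (SUP n. \<phi> (s n))"
  using assms by (auto simp: functionals_def dest: monoD)

text \<open>For an order-preserving additive \<open>\<mu>\<close> vanishing at 0, this is the
  largest functional below \<open>\<mu>\<close>. It repairs pointwise limits and differences of
  functionals, which may fail to preserve suprema of increasing sequences.\<close>

definition regularization :: "('a::cu_semigroup \<Rightarrow> ennreal) \<Rightarrow> 'a \<Rightarrow> ennreal" where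
  "regularization \<mu> x = (SUP x'\<in>{x'. x' \<lless> x}. \<mu> x')"

lemma regularization_ge: "x' \<lless> x \<Longrightarrow> \<mu> x' \<le> regularization \<mu> x"
  unfolding regularization_def by (rule SUP_upper) simp

lemma regularization_least: "(\<And>x'. x' \<lless> x \<Longrightarrow> \<mu> x' \<le> b) \<Longrightarrow> regularization \<mu> x \<le> b"
  unfolding regularization_def by (rule SUP_least) simp

lemma regularization_le: "mono \<mu> \<Longrightarrow> regularization \<mu> x \<le> \<mu> x"
  by (rule regularization_least) (auto dest: way_below_le monoD)

lemma regularization_compact:
  "mono \<mu> \<Longrightarrow> compact_element u \<Longrightarrow> regularization \<mu> u = \<mu> u"
  by (rule antisym) (auto simp: compact_element_def regularization_le regularization_ge)

lemma way_below_chain: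
  fixes x :: "'a::cu_semigroup"
  shows "\<exists>s. (\<forall>n. s n \<lless> s (Suc n)) \<and> incseq s \<and> seq_sup s x"
proof -
  obtain s where s: "\<And>n. s n \<lless> s (Suc n)" "seq_sup s x" using cu_O2[of x] by blast
  moreover have "incseq s" by (rule incseq_SucI) (use s way_below_le in blast)
  ultimately show ?thesis by blast
qed

text \<open>A single rapidly increasing sequence is cofinal among the elements way below
  \<open>x\<close>, so the supremum over a set becomes one along a sequence, where (O4) and
  continuity of addition apply.\<close>

lemma regularization_chain:
  assumes "mono \<mu>" "\<And>n. s n \<lless> s (Suc n)" "seq_sup s x"
  shows "regularization \<mu> x = (SUP n. \<mu> (s n))"
proof (rule antisym)
  have s: "incseq s" by (rule incseq_SucI) (use assms way_below_le in blast)
  show "regularization \<mu> x \<le> (SUP n. \<mu> (s n))"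
  proof (rule regularization_least)
    fix x' assume "x' \<lless> x"
    then obtain n where "x' \<le> s n" using s assms(3) order_refl[of x] unfolding way_below_def by blast
    then show "\<mu> x' \<le> (SUP n. \<mu> (s n))" using assms(1) by (meson SUP_upper2 UNIV_I monoD)
  qed
  have "s n \<lless> x" for n
    using assms way_below_le_trans[of "s n" "s (Suc n)" x] by (auto simp: seq_sup_def)
  then show "(SUP n. \<mu> (s n)) \<le> regularization \<mu> x"
    by (auto intro!: SUP_least regularization_ge)
qed

text \<open>Used to bound a functional at \<open>x\<close> by bounding it only at elements way below
  \<open>x\<close>, the setting in which (O5) provides complements.\<close>

lemma regularization_functional:
  fixes \<phi> :: "'a::cu_semigroup \<Rightarrow> ennreal"
  assumes "\<phi> \<in> functionals"
  shows "regularization \<phi> = \<phi>"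
proof
  fix x :: 'a
  obtain s where s: "\<And>n. s n \<lless> s (Suc n)" "incseq s" "seq_sup s x"
    using way_below_chain[of x] by blast
  moreover have "mono \<phi>" using assms by (simp add: functionals_def)
  ultimately show "regularization \<phi> x = \<phi> x"
    using regularization_chain functionalsD(4)[OF assms] by metis
qed

text \<open>Additivity holds because, by (O3) and (O4), the sums of two rapidly increasing sequences
  again form such a sequence, with supremum \<open>x + y\<close>. Suprema are preserved because of
  interpolation: \<open>x' \<lless> z \<lless> l\<close> puts \<open>z\<close> below some
  \<open>s n\<close>.\<close>

lemma regularization_in_functionals:
  fixes \<mu> :: "'a::cu_semigroup \<Rightarrow> ennreal"
  assumes mono: "mono \<mu>" and zero: "\<mu> 0 = 0" and add: "\<And>x y. \<mu> (x + y) = \<mu> x + \<mu> y"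
  shows "regularization \<mu> \<in> functionals"
proof -
  have m: "mono (regularization \<mu>)"
    by (rule monoI) (auto intro!: regularization_least regularization_ge intro: way_below_le_trans)
  have "regularization \<mu> 0 = 0"
    using regularization_le[OF mono, of 0] zero by simp
  moreover have "regularization \<mu> (x + y) = regularization \<mu> x + regularization \<mu> y" for x y
  proof -
    obtain s where s: "\<And>n. s n \<lless> s (Suc n)" "incseq s" "seq_sup s x"
    using way_below_chain[of x] by blast
    obtain t where t: "\<And>n. t n \<lless> t (Suc n)" "incseq t" "seq_sup t y"
      using way_below_chain[of y] by blast
    have "regularization \<mu> (x + y) = (SUP n. \<mu> (s n + t n))"
      using s t by (intro regularization_chain mono cu_O3 cu_O4) auto
    also have "\<dots> = (SUP n. \<mu> (s n)) + (SUP n. \<mu> (t n))"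
      unfolding add using s t
      by (intro ennreal_SUP_add) (auto simp: incseq_def intro: monoD[OF mono])
    finally show ?thesis using regularization_chain[OF mono] s t by metis
  qed
  moreover have "regularization \<mu> l = (SUP n. regularization \<mu> (s n))"
    if s: "incseq s" "seq_sup s l" for s l
  proof (rule antisym)
    show "regularization \<mu> l \<le> (SUP n. regularization \<mu> (s n))"
    proof (rule regularization_least)
      fix x' assume "x' \<lless> l"
      then obtain z where z: "x' \<lless> z" "z \<lless> l" by (rule way_below_interpolate)
      then obtain n where "z \<le> s n" using s order_refl[of l] unfolding way_below_def by blast
      then have "\<mu> x' \<le> regularization \<mu> (s n)"
        using z by (meson regularization_ge way_below_le_trans)
      then show "\<mu> x' \<le> (SUP n. regularization \<mu> (s n))" by (meson SUP_upper2 UNIV_I)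
    qed
    show "(SUP n. regularization \<mu> (s n)) \<le> regularization \<mu> l"
      using that by (auto intro!: SUP_least monoD[OF m] simp: seq_sup_def)
  qed
  ultimately show ?thesis using m unfolding functionals_def by blast
qed

lemma functionals_scale:
  assumes "\<phi> \<in> functionals"
  shows "(\<lambda>x. c * \<phi> x) \<in> functionals"
  using assms unfolding functionals_def
  by (auto simp: mono_def mult_left_mono distrib_left SUP_mult_left_ennreal)

text \<open>Subtraction of extended reals satisfies \<open>\<infinity> - a = \<infinity>\<close>, also for \<open>a = \<infinity>\<close>; this is the value
  needed where \<open>\<phi>\<close> is infinite.\<close>

lemma functional_difference:
  fixes \<phi> \<psi> :: "'a::cu_semigroup_O5 \<Rightarrow> ennreal"
  assumes \<phi>: "\<phi> \<in> functionals" and \<psi>: "\<psi> \<in> functionals" and le: "\<And>x. \<psi> x \<le> \<phi> x"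
  shows "mono (\<lambda>x. \<phi> x - \<psi> x)" "regularization (\<lambda>x. \<phi> x - \<psi> x) \<in> functionals"
proof -
  show mono: "mono (\<lambda>x. \<phi> x - \<psi> x)"
  proof (rule monoI)
    fix y x :: 'a assume "y \<le> x"
    show "\<phi> y - \<psi> y \<le> \<phi> x - \<psi> x"
    proof (cases "\<phi> x = top")
      case False
      have fin: "\<phi> z < top \<and> \<psi> z < top" if "z \<le> x" for z
        using functionalsD(1)[OF \<phi> that] le[of z] False
        by (metis order_le_less_trans top.not_eq_extremum)
      \<comment> \<open>By (O5), \<open>z\<close> is an approximate complement of \<open>y\<close>
        in \<open>x\<close>. Then \<open>\<phi> y' \<le> \<phi> x - \<phi> z \<le> \<phi> x - \<psi>
        z\<close>, and \<open>\<psi> z \<ge> \<psi> x - \<psi> y\<close>. All values are finite, so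
        this is linear arithmetic over the reals.\<close>
      have "\<phi> y' \<le> \<psi> y + (\<phi> x - \<psi> x)" if y': "y' \<lless> y" for y'
      proof -
        obtain z where z: "y' + z \<le> x" "x \<le> y + z" using cu_O5[OF y' \<open>y \<le> x\<close>] by blast
        have "z \<le> x"
          using z(1) add_right_mono[OF cu_zero_le[of y'], of z] by (simp add: order_trans)
        have "y' \<le> x" using y' \<open>y \<le> x\<close> way_below_le order_trans by blast
        have 1: "\<phi> y' + \<phi> z \<le> \<phi> x" using z(1) functionalsD[OF \<phi>] by metis
        have 2: "\<psi> x \<le> \<psi> y + \<psi> z" using z(2) functionalsD[OF \<psi>] by metis
        obtain a b c where "\<phi> y' = ennreal a" "\<phi> z = ennreal b" "\<phi> x = ennreal c"
            "0 \<le> a" "0 \<le> b" "0 \<le> c"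
          using fin[OF \<open>y' \<le> x\<close>] fin[OF \<open>z \<le> x\<close>] fin[OF order_refl]
          by (auto simp: less_top_ennreal)
        moreover obtain p q r where "\<psi> y = ennreal p" "\<psi> z = ennreal q" "\<psi> x = ennreal r"
            "0 \<le> p" "0 \<le> q" "0 \<le> r"
          using fin[OF \<open>y \<le> x\<close>] fin[OF \<open>z \<le> x\<close>] fin[OF order_refl]
          by (auto simp: less_top_ennreal)
        ultimately show ?thesis
          using 1 2 le[of z] le[of x]
          by (simp add: ennreal_minus flip: ennreal_plus)
      qed
      then have "\<phi> y \<le> \<psi> y + (\<phi> x - \<psi> x)"
        by (subst regularization_functional[OF \<phi>, symmetric]) (rule regularization_least)
      then show ?thesis using fin[OF \<open>y \<le> x\<close>] by (auto simp: ennreal_minus_le_iff)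
    qed simp
  qed
  have "\<phi> (x + y) - \<psi> (x + y) = (\<phi> x - \<psi> x) + (\<phi> y - \<psi> y)" for x y
  proof (cases "\<phi> x = top \<or> \<phi> y = top")
    case True
    then show ?thesis by (auto simp: functionalsD(3)[OF \<phi>])
  next
    case False
    then obtain a b where ab: "\<phi> x = ennreal a" "\<phi> y = ennreal b" "0 \<le> a" "0 \<le> b"
      by (metis less_top_ennreal top.not_eq_extremum)
    moreover have "\<psi> x < top" "\<psi> y < top"
      using le[of x] le[of y] ab by (metis order_le_less_trans ennreal_less_top)+
    then obtain p q where "\<psi> x = ennreal p" "\<psi> y = ennreal q" "0 \<le> p" "0 \<le> q"
      by (metis less_top_ennreal)
    ultimately show ?thesis
      using le[of x] le[of y]
      by (simp add: functionalsD(3)[OF \<phi>] functionalsD(3)[OF \<psi>] ennreal_minus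
          flip: ennreal_plus)
  qed
  then show "regularization (\<lambda>x. \<phi> x - \<psi> x) \<in> functionals"
    by (intro regularization_in_functionals mono) (auto simp: functionalsD[OF \<phi>] functionalsD[OF \<psi>])
qed

subsection \<open>Multiples of a full element\<close>

primrec multiple :: "nat \<Rightarrow> 'a::comm_monoid_add \<Rightarrow> 'a" where
  "multiple 0 x = 0"
| "multiple (Suc n) x = x + multiple n x"

lemma multiple_add: "multiple (m + n) x = multiple m x + multiple n x"
  by (induction m) (auto simp: add.assoc)

lemma functional_multiple:
  "\<phi> \<in> functionals \<Longrightarrow> \<phi> (multiple n x) = of_nat n * \<phi> x"
  by (induction n) (auto simp: functionalsD algebra_simps)

lemma functional_sum:
  "\<phi> \<in> functionals \<Longrightarrow> \<phi> (sum f A) = (\<Sum>i\<in>A. \<phi> (f i))"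
  by (induction A rule: infinite_finite_induct) (auto simp: functionalsD)

lemma cu_le_add: "(x::'a::cu_semigroup) \<le> y + x" "x \<le> x + y"
  using add_right_mono[OF cu_zero_le[of y], of x] by (auto simp: add.commute)

lemma incseq_multiple: "incseq (\<lambda>n. multiple n (x::'a::cu_semigroup))"
  by (rule incseq_SucI) (simp add: cu_le_add)

lemma full_element_mono:
  assumes "full_element x" "x \<le> y"
  shows "full_element y"
proof -
  have "cu_ideal hull {x} \<subseteq> cu_ideal hull {y}"
    using assms(2) unfolding hull_def cu_ideal_def by blast
  then show ?thesis using assms(1) unfolding full_element_def by blast
qed

text \<open>The supremum \<open>w\<close> of the multiples of \<open>u\<close> satisfies
  \<open>w + w \<le> w\<close> by (O4), so the elements below \<open>w\<close> form an ideal
  containing \<open>u\<close>, hence everything.\<close>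

lemma full_element_way_below_multiple:
  fixes u :: "'a::cu_semigroup"
  assumes "full_element u" "x' \<lless> x"
  shows "\<exists>n. x' \<le> multiple n u"
proof -
  obtain w where w: "seq_sup (\<lambda>n. multiple n u) w" using cu_O1[OF incseq_multiple] by blast
  have "seq_sup (\<lambda>n. multiple n u + multiple n u) (w + w)"
    by (rule cu_O4) (use w incseq_multiple in auto)
  moreover have "multiple n u + multiple n u \<le> w" for n
    using w by (auto simp: seq_sup_def multiple_add[symmetric])
  ultimately have ww: "w + w \<le> w" unfolding seq_sup_def by blast
  have "cu_ideal {x. x \<le> w}"
    unfolding cu_ideal_def
  proof (intro conjI ballI allI impI; clarsimp?)
    show "0 \<le> w" by (rule cu_zero_le)
    show "x + y \<le> w" if "x \<le> w" "y \<le> w" for x y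
      using add_mono[OF that] ww by (rule order_trans)
    show "x \<le> w" if "y \<le> w" "x \<le> y" for x y using that by (rule order_trans[rotated])
    show "l \<le> w" if "\<forall>n. s n \<le> w" "seq_sup s l" for s :: "nat \<Rightarrow> 'a" and l
      using that by (auto simp: seq_sup_def)
  qed
  moreover have "u \<le> w"
    using w unfolding seq_sup_def by (metis multiple.simps add_0_right)
  ultimately have "cu_ideal hull {u} \<subseteq> {x. x \<le> w}" by (intro hull_minimal) auto
  then have "x \<le> w" using assms(1) unfolding full_element_def by auto
  then show ?thesis
    using assms(2) w incseq_multiple unfolding way_below_def by blast
qed

lemma normalized_functional_multiple:
  "\<phi> \<in> normalized_functionals u \<Longrightarrow> \<phi> (multiple n u) = of_nat n"
  by (auto simp: normalized_functionals_def functional_multiple)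

text \<open>The source of finiteness: the bound is common to all normalized functionals.\<close>

lemma normalized_functional_bound:
  "\<phi> \<in> normalized_functionals u \<Longrightarrow> x \<le> multiple n u \<Longrightarrow> \<phi> x \<le> of_nat n"
  using functionalsD(1)[of \<phi> x "multiple n u"] normalized_functional_multiple[of \<phi> u n]
  by (simp add: normalized_functionals_def)

subsection \<open>A finite minimax principle\<close>

text \<open>\<open>C\<close> misses the open quadrant below \<open>(c, c)\<close>. A separating
  normal vector has nonnegative coordinates, because the quadrant is unbounded downwards; scaled to
  sum 1, it gives the weights.\<close>

lemma two_function_weights:
  fixes C :: "(real \<times> real) set"
  assumes conv: "convex C" and C: "\<And>p q. (p, q) \<in> C \<Longrightarrow> c \<le> p \<or> c \<le> q"
  shows "\<exists>s. 0 \<le> s \<and> s \<le> 1 \<and> (\<forall>(p, q)\<in>C. c \<le> s * p + (1 - s) * q)"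
proof (cases "C = {}")
  case False
  define D where "D = {..<c} \<times> {..<c}"
  have "convex D" "D \<noteq> {}" "D \<inter> C = {}"
    using C lt_ex[of c] by (force simp: D_def convex_Times)+
  then obtain a b where ab: "a \<noteq> 0" "\<And>x. x \<in> D \<Longrightarrow> a \<bullet> x \<le> b" "\<And>x. x \<in> C \<Longrightarrow> b \<le> a \<bullet> x"
    using separating_hyperplane_sets[of D C] conv False by blast
  obtain \<alpha> \<beta> where a: "a = (\<alpha>, \<beta>)" by (cases a)
  have D: "\<alpha> * p + \<beta> * q \<le> b" if "p < c" "q < c" for p q
    using ab(2)[of "(p, q)"] that by (simp add: a D_def)
  have "0 \<le> \<alpha>"
  proof (rule ccontr)
    assume neg: "\<not> 0 \<le> \<alpha>"
    \<comment> \<open>For negative \<open>\<alpha>\<close>, \<open>p\<close> is far enough down that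
      \<open>\<alpha> * p + \<beta> * (c - 1)\<close> exceeds \<open>b\<close>.\<close>
    define p where "p = min (c - 1) ((b + 1 - \<beta> * (c - 1)) / \<alpha>)"
    have "p \<le> (b + 1 - \<beta> * (c - 1)) / \<alpha>" by (simp add: p_def)
    then have "b + 1 - \<beta> * (c - 1) \<le> \<alpha> * p" using neg by (simp add: field_simps)
    moreover have "p < c" by (simp add: p_def)
    ultimately show False using D[of p "c - 1"] by simp
  qed
  moreover have "0 \<le> \<beta>"
  proof (rule ccontr)
    assume neg: "\<not> 0 \<le> \<beta>"
    define q where "q = min (c - 1) ((b + 1 - \<alpha> * (c - 1)) / \<beta>)"
    have "q \<le> (b + 1 - \<alpha> * (c - 1)) / \<beta>" by (simp add: q_def)
    then have "b + 1 - \<alpha> * (c - 1) \<le> \<beta> * q" using neg by (simp add: field_simps)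
    moreover have "q < c" by (simp add: q_def)
    ultimately show False using D[of "c - 1" q] by simp
  qed
  ultimately have pos: "0 \<le> \<alpha>" "0 \<le> \<beta>" "0 < \<alpha> + \<beta>"
    using ab(1) by (auto simp: a zero_prod_def)
  \<comment> \<open>The corner \<open>(c, c)\<close> is not in the open quadrant, so it is
    approached along the diagonal.\<close>
  have cb: "(\<alpha> + \<beta>) * c \<le> b"
  proof (rule field_le_epsilon)
    fix e :: real assume "0 < e"
    then have "\<alpha> * (c - e / (\<alpha> + \<beta>)) + \<beta> * (c - e / (\<alpha> + \<beta>)) \<le> b"
      using pos by (intro D) auto
    also have "\<alpha> * (c - e / (\<alpha> + \<beta>)) + \<beta> * (c - e / (\<alpha> + \<beta>)) = (\<alpha> + \<beta>) * (c - e / (\<alpha> + \<beta>))"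
      by (simp flip: distrib_right)
    also have "\<dots> = (\<alpha> + \<beta>) * c - e" using pos by (simp add: right_diff_distrib)
    finally show "(\<alpha> + \<beta>) * c \<le> b + e" by simp
  qed
  have "c \<le> \<alpha> / (\<alpha> + \<beta>) * p + (1 - \<alpha> / (\<alpha> + \<beta>)) * q" if "(p, q) \<in> C" for p q
  proof -
    have "1 - \<alpha> / (\<alpha> + \<beta>) = \<beta> / (\<alpha> + \<beta>)" using pos by (simp add: field_simps)
    moreover have "c * (\<alpha> + \<beta>) \<le> \<alpha> * p + \<beta> * q"
      using ab(3)[OF that] cb by (simp add: a mult.commute)
    ultimately show ?thesis
      using pos by (simp add: pos_le_divide_eq flip: add_divide_distrib)
  qed
  then show ?thesis using pos by (intro exI[of _ "\<alpha> / (\<alpha> + \<beta>)"]) auto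
qed auto

text \<open>Induction on the number of coordinates reduces this to the planar case. Only strictly
  positive weights are assumed for \<open>V\<close>, matching \<open>convex_functionals\<close>; the
  endpoints are trivial.\<close>

lemma finite_minimax_weights:
  fixes V :: "('i \<Rightarrow> real) set"
  assumes "finite A" "A \<noteq> {}"
    and "\<And>v w s t. v \<in> V \<Longrightarrow> w \<in> V \<Longrightarrow> 0 < s \<Longrightarrow> 0 < t \<Longrightarrow> s + t = 1
          \<Longrightarrow> (\<lambda>i. s * v i + t * w i) \<in> V"
    and "\<And>v. v \<in> V \<Longrightarrow> \<exists>i\<in>A. c \<le> v i"
  shows "\<exists>t. (\<forall>i\<in>A. 0 \<le> t i) \<and> sum t A = 1 \<and> (\<forall>v\<in>V. c \<le> (\<Sum>i\<in>A. t i * v i))"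
  using assms
proof (induction A arbitrary: V rule: finite_ne_induct)
  case (singleton a)
  then show ?case by (intro exI[of _ "\<lambda>_. 1"]) auto
next
  case (insert a A)
  \<comment> \<open>The induction hypothesis treats the convex part of \<open>V\<close> on which the coordinate \<open>a\<close> is too small;
    the two remaining affine functions are then balanced in the plane.\<close>
  have "\<exists>t. (\<forall>i\<in>A. 0 \<le> t i) \<and> sum t A = 1 \<and> (\<forall>v\<in>{v \<in> V. v a < c}. c \<le> (\<Sum>i\<in>A. t i * v i))"
  proof (rule insert.IH)
    fix v w and s t :: real
    assume vw: "v \<in> {v \<in> V. v a < c}" "w \<in> {v \<in> V. v a < c}" and st: "0 < s" "0 < t" "s + t = 1"
    have "s * v a + t * w a < s * c + t * c"
      using vw st by (intro add_strict_mono) auto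
    then show "(\<lambda>i. s * v i + t * w i) \<in> {v \<in> V. v a < c}"
      using insert.prems(1) vw st by (simp flip: distrib_right)
  next
    fix v assume "v \<in> {v \<in> V. v a < c}"
    then show "\<exists>i\<in>A. c \<le> v i" using insert.prems(2)[of v] by auto
  qed
  then obtain t where t: "\<And>i. i \<in> A \<Longrightarrow> 0 \<le> t i" "sum t A = 1"
    "\<And>v. v \<in> V \<Longrightarrow> v a < c \<Longrightarrow> c \<le> (\<Sum>i\<in>A. t i * v i)" by blast
  define h where "h v = (v a, \<Sum>i\<in>A. t i * v i)" for v
  have h: "x *\<^sub>R h v + y *\<^sub>R h w = h (\<lambda>i. x * v i + y * w i)" for x y v w
    by (simp add: h_def sum_distrib_left sum.distrib algebra_simps)
  have "convex (h ` V)"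
    unfolding convex_def
  proof (intro ballI allI impI)
    fix p q and x y :: real
    assume pq: "p \<in> h ` V" "q \<in> h ` V" and xy: "0 \<le> x" "0 \<le> y" "x + y = 1"
    consider "x = 0" "y = 1" | "y = 0" "x = 1" | "0 < x" "0 < y" using xy by fastforce
    then show "x *\<^sub>R p + y *\<^sub>R q \<in> h ` V"
    proof cases
      case 3
      then show ?thesis using pq xy insert.prems(1) by (auto simp: h)
    qed (use pq in auto)
  qed
  moreover have "c \<le> p \<or> c \<le> q" if "(p, q) \<in> h ` V" for p q
    using that t(3) by (force simp: h_def)
  ultimately obtain s where s: "0 \<le> s" "s \<le> 1"
    "\<And>p q. (p, q) \<in> h ` V \<Longrightarrow> c \<le> s * p + (1 - s) * q"
    using two_function_weights[of "h ` V" c] by blast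
  define t' where "t' i = (if i = a then s else (1 - s) * t i)" for i
  have t'A: "(\<Sum>i\<in>insert a A. t' i * v i) = s * v a + (1 - s) * (\<Sum>i\<in>A. t i * v i)" for v
  proof -
    have "(\<Sum>i\<in>A. t' i * v i) = (\<Sum>i\<in>A. (1 - s) * (t i * v i))"
      using insert.hyps by (intro sum.cong) (auto simp: t'_def)
    then show ?thesis using insert.hyps by (simp add: t'_def sum_distrib_left)
  qed
  show ?case
  proof (intro exI[of _ t'] conjI ballI)
    show "0 \<le> t' i" if "i \<in> insert a A" for i using that s t(1) by (auto simp: t'_def)
    show "sum t' (insert a A) = 1" using t'A[of "\<lambda>_. 1"] t(2) by simp
    show "c \<le> (\<Sum>i\<in>insert a A. t' i * v i)" if "v \<in> V" for v
      unfolding t'A using that by (intro s(3)) (auto simp: h_def)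
  qed
qed

subsection \<open>Domination by elements of a closed set\<close>

text \<open>A compactness argument: a cluster point of the approximate solutions, made into a
  functional, lies in the closed set \<open>K\<close>. Testing on elements below multiples of
  \<open>u\<close> suffices, since every element way below another is of this kind.\<close>

lemma closed_set_dominated_functional:
  fixes u :: "'a::cu_semigroup" and \<psi> :: "'a \<Rightarrow> ennreal"
  assumes u_full: "full_element u" and u_compact: "compact_element u"
    and K_closed: "closedin (subtopology functional_topology (normalized_functionals u)) K"
    and mono_\<psi>: "mono \<psi>"
    and approx: "\<And>A e. finite A \<Longrightarrow> \<forall>x\<in>A. \<exists>n. x \<le> multiple n u \<Longrightarrow> 0 < (e::real)
          \<Longrightarrow> \<exists>\<kappa>\<in>K. \<forall>x\<in>A. \<kappa> x \<le> \<psi> x + ennreal e"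
  shows "\<exists>\<kappa>\<in>K. \<forall>x. \<kappa> x \<le> \<psi> x"
proof -
  have KF: "K \<subseteq> normalized_functionals u" using closedin_subset[OF K_closed] by auto
  \<comment> \<open>The pairs \<open>(A, e)\<close> are directed by union and minimum, so the sets
    of approximate solutions, nonempty by \<open>approx\<close>, form a filter base.\<close>
  define P where "P = {(A, e). finite A \<and> (\<forall>x\<in>A. \<exists>n. x \<le> multiple n u) \<and> 0 < (e::real)}"
  define G where "G = (\<lambda>(A, e). principal {\<kappa>\<in>K. \<forall>x\<in>A. \<kappa> x \<le> \<psi> x + ennreal e})"
  define F0 where "F0 = (INF p\<in>P. G p)"
  have ev0: "eventually Q F0 \<longleftrightarrow> (\<exists>p\<in>P. eventually Q (G p))" for Q
    unfolding F0_def
  proof (rule eventually_INF_base)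
    show "P \<noteq> {}" by (auto simp: P_def intro!: exI[of _ "{}"] exI[of _ 1])
    fix p q assume pq: "p \<in> P" "q \<in> P"
    show "\<exists>r\<in>P. G r \<le> inf (G p) (G q)"
    proof (intro bexI[of _ "(fst p \<union> fst q, min (snd p) (snd q))"])
      have "ennreal (min (snd p) (snd q)) \<le> ennreal (snd p)"
        "ennreal (min (snd p) (snd q)) \<le> ennreal (snd q)" by (auto intro: ennreal_leI)
      then show "G (fst p \<union> fst q, min (snd p) (snd q)) \<le> inf (G p) (G q)"
        by (auto simp: G_def case_prod_unfold) (meson UnCI add_left_mono order_trans)+
    qed (use pq in \<open>auto simp: P_def\<close>)
  qed
  have "F0 \<noteq> bot"
    unfolding trivial_limit_def ev0
    using approx by (fastforce simp: P_def G_def eventually_principal)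
  \<comment> \<open>Tychonoff for a power of the compact space \<open>[0, \<infinity>]\<close>; the
    resulting filter \<open>F\<close> refines \<open>F0\<close> and converges pointwise to
    \<open>\<mu>\<close>.\<close>
  moreover have "compact (UNIV :: ('a \<Rightarrow> ennreal) set)"
  proof -
    have "compact_space (euclidean :: ('a \<Rightarrow> ennreal) topology)"
      unfolding euclidean_product_topology[symmetric] compact_space_product_topology
      by (simp add: compact_space_def compact_UNIV)
    then show ?thesis by (simp add: compact_space_def)
  qed
  ultimately obtain \<mu> where \<mu>: "inf (nhds \<mu>) F0 \<noteq> bot"
    unfolding compact_filter by force
  define F where "F = inf (nhds \<mu>) F0"
  have [simp]: "F \<noteq> bot" using \<mu> by (simp add: F_def)
  have lim: "((\<lambda>\<kappa>. \<kappa> x) \<longlongrightarrow> \<mu> x) F" for x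
  proof (rule tendsto_mono)
    show "((\<lambda>\<kappa>. \<kappa> x) \<longlongrightarrow> \<mu> x) (nhds \<mu>)"
    proof (rule topological_tendstoI)
      fix U :: "ennreal set" assume "open U" "\<mu> x \<in> U"
      moreover have "open ((\<lambda>\<kappa> :: 'a \<Rightarrow> ennreal. \<kappa> x) -` U)"
        using \<open>open U\<close> by (rule open_vimage) (rule continuous_on_product_coordinates)
      ultimately show "\<forall>\<^sub>F \<kappa> in nhds \<mu>. \<kappa> x \<in> U" by (force simp: eventually_nhds)
    qed
  qed (simp add: F_def)
  have evF: "eventually Q F" if "p \<in> P" "eventually Q (G p)" for p Q
  proof -
    have "F \<le> F0" by (simp add: F_def)
    moreover have "eventually Q F0" using that ev0 by blast
    ultimately show ?thesis by (rule filter_leD)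
  qed
  have evK: "eventually (\<lambda>\<kappa>. \<kappa> \<in> K) F"
    by (rule evF[of "({}, 1)"]) (auto simp: P_def G_def eventually_principal)
  have evN: "eventually (\<lambda>\<kappa>. \<kappa> \<in> normalized_functionals u) F"
    using evK by eventually_elim (use KF in blast)
  have evfun: "eventually (\<lambda>\<kappa>. \<kappa> \<in> functionals) F"
    using evN by eventually_elim (simp add: normalized_functionals_def)
  have mono: "mono \<mu>"
  proof (rule monoI)
    fix x y :: 'a assume "x \<le> y"
    from evfun have "eventually (\<lambda>\<kappa>. \<kappa> x \<le> \<kappa> y) F"
      by eventually_elim (use \<open>x \<le> y\<close> functionalsD in blast)
    then show "\<mu> x \<le> \<mu> y" using lim by (intro tendsto_le[of F]) auto
  qed
  have const: "\<mu> x = c" if "eventually (\<lambda>\<kappa>. \<kappa> x = c) F" for x c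
    using tendsto_unique[OF _ lim[of x] tendsto_eventually[OF that]] by simp
  have zero: "\<mu> 0 = 0"
    by (rule const) (use evfun in eventually_elim, simp add: functionalsD)
  have unit: "\<mu> u = 1"
    by (rule const) (use evN in eventually_elim, simp add: normalized_functionals_def)
  have add: "\<mu> (x + y) = \<mu> x + \<mu> y" for x y
  proof (rule tendsto_unique)
    show "((\<lambda>\<kappa>. \<kappa> (x + y)) \<longlongrightarrow> \<mu> (x + y)) F" by (rule lim)
    have "eventually (\<lambda>\<kappa>. \<kappa> x + \<kappa> y = \<kappa> (x + y)) F"
      using evfun by eventually_elim (simp add: functionalsD)
    then show "((\<lambda>\<kappa>. \<kappa> (x + y)) \<longlongrightarrow> \<mu> x + \<mu> y) F"
      by (rule Lim_transform_eventually[rotated]) (intro tendsto_add lim)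
  qed simp
  \<comment> \<open>The pointwise cluster point \<open>\<mu>\<close> need not preserve suprema; its regularization does, and it is
    the limit of the same filter in the topology of functionals.\<close>
  define \<phi> where "\<phi> = regularization \<mu>"
  have \<phi>: "\<phi> \<in> functionals"
    unfolding \<phi>_def using mono zero add by (rule regularization_in_functionals)
  \<comment> \<open>Compactness of \<open>u\<close> ensures that regularization does not lower the
    value at \<open>u\<close>.\<close>
  have \<phi>N: "\<phi> \<in> normalized_functionals u"
    using \<phi> unit regularization_compact[OF mono u_compact]
    by (simp add: normalized_functionals_def \<phi>_def)
  have "functionals_converge (\<lambda>\<kappa>. \<kappa>) \<phi> F"
    unfolding functionals_converge_def
  proof (intro conjI allI impI \<phi> evfun)
    fix x' x :: 'a assume "x' \<lless> x"
    \<comment> \<open>Pointwise convergence reduces both bounds to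
      \<open>\<mu> x' \<le> \<phi> x \<le> \<mu> x\<close>.\<close>
    have "Limsup F (\<lambda>\<kappa>. \<kappa> x') = \<mu> x'" by (rule lim_imp_Limsup) (auto intro: lim)
    then show "Limsup F (\<lambda>\<kappa>. \<kappa> x') \<le> \<phi> x"
      using regularization_ge[OF \<open>x' \<lless> x\<close>, of \<mu>] by (simp add: \<phi>_def)
    have "Liminf F (\<lambda>\<kappa>. \<kappa> x) = \<mu> x" by (rule lim_imp_Liminf) (auto intro: lim)
    then show "\<phi> x \<le> Liminf F (\<lambda>\<kappa>. \<kappa> x)"
      using regularization_le[OF mono, of x] by (simp add: \<phi>_def)
  qed
  then have "limitin functional_topology (\<lambda>\<kappa>. \<kappa>) \<phi> F" by (simp add: limitin_functional_topology)
  then have "limitin (subtopology functional_topology (normalized_functionals u)) (\<lambda>\<kappa>. \<kappa>) \<phi> F"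
    using \<phi>N evN by (simp add: limitin_subtopology)
  then have "\<phi> \<in> K"
    using K_closed evK by (rule limitin_closedin) simp
  moreover have "\<phi> x \<le> \<psi> x" for x
    unfolding \<phi>_def
  proof (rule regularization_least)
    fix x' assume "x' \<lless> x"
    then obtain n where n: "x' \<le> multiple n u" using full_element_way_below_multiple[OF u_full] by blast
    have "\<mu> x' \<le> \<psi> x'"
    proof (rule ennreal_le_epsilon)
      fix e :: real assume "0 < e"
      then have "eventually (\<lambda>\<kappa>. \<kappa> x' \<le> \<psi> x' + ennreal e) F"
        using n by (intro evF[of "({x'}, e)"]) (auto simp: P_def G_def eventually_principal)
      then show "\<mu> x' \<le> \<psi> x' + ennreal e"
        using lim by (intro tendsto_upperbound[of _ _ F]) auto
    qed
    also have "\<psi> x' \<le> \<psi> x" using mono_\<psi> way_below_le[OF \<open>x' \<lless> x\<close>] by (rule monoD)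
    finally show "\<mu> x' \<le> \<psi> x" .
  qed
  ultimately show ?thesis by blast
qed

lemma finite_domination_of_comparison:
  fixes u :: "'a::cu_semigroup"
  assumes u_full: "full_element u"
    and KF: "K \<subseteq> normalized_functionals u"
    and K_convex: "convex_functionals K"
    and M_pos: "0 < M"
    and comparison: "\<And>x y :: 'a. full_element y \<Longrightarrow> (\<forall>\<phi>\<in>K. \<phi> x \<le> \<phi> y) \<Longrightarrow>
          (\<forall>\<phi>\<in>functionals. \<phi> x \<le> ennreal M * \<phi> y)"
    and \<phi>: "\<phi> \<in> normalized_functionals u"
    and A: "finite A" "\<forall>x\<in>A. \<exists>n. x \<le> multiple n u"
    and e: "0 < (e::real)"
  shows "\<exists>\<kappa>\<in>K. \<forall>x\<in>A. \<kappa> x \<le> ennreal M * \<phi> x + ennreal e"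
proof -
  \<comment> \<open>Inserting \<open>0\<close> makes the index set nonempty, so that the case \<open>K = {}\<close> is refuted as well.\<close>
  define B where "B = insert 0 A"
  have B: "finite B" "B \<noteq> {}" "\<And>x. x \<in> B \<Longrightarrow> \<exists>n. x \<le> multiple n u"
    using A cu_zero_le by (auto simp: B_def)
  define r where "r \<kappa> x = enn2real (\<kappa> x)" for \<kappa> and x :: 'a
  have r: "\<kappa> x = ennreal (r \<kappa> x)" if "\<kappa> \<in> normalized_functionals u" "x \<in> B" for \<kappa> x
  proof -
    have "\<kappa> x < top"
      using normalized_functional_bound[OF that(1)] B(3)[OF that(2)]
      by (metis of_nat_less_top order_le_less_trans)
    then show ?thesis by (simp add: r_def)
  qed
  have r0: "0 \<le> r \<kappa> x" for \<kappa> x by (simp add: r_def)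
  \<comment> \<open>The excess of \<open>\<kappa>\<close> over \<open>M * \<phi>\<close>. Outside
    \<open>B\<close> values may be infinite and \<open>r\<close> need not respect convex
    combinations, hence the value 0 there.\<close>
  define v where "v \<kappa> x = (if x \<in> B then r \<kappa> x - M * r \<phi> x else 0)" for \<kappa> x
  have "\<exists>\<kappa>\<in>K. \<forall>x\<in>B. v \<kappa> x < e"
  proof (rule ccontr)
    assume contr: "\<not> ?thesis"
    have "\<exists>t. (\<forall>x\<in>B. 0 \<le> t x) \<and> sum t B = 1 \<and> (\<forall>w\<in>v ` K. e \<le> (\<Sum>x\<in>B. t x * w x))"
    proof (rule finite_minimax_weights[OF B(1,2)])
      fix w w' and s t :: real
      assume "w \<in> v ` K" "w' \<in> v ` K" and st: "0 < s" "0 < t" "s + t = 1"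
      then obtain \<kappa> \<kappa>' where \<kappa>: "\<kappa> \<in> K" "\<kappa>' \<in> K" "w = v \<kappa>" "w' = v \<kappa>'" by auto
      define \<nu> where "\<nu> = (\<lambda>x. ennreal s * \<kappa> x + ennreal t * \<kappa>' x)"
      have "\<nu> \<in> K" using K_convex \<kappa> st unfolding convex_functionals_def \<nu>_def by blast
      moreover have "s * w x + t * w' x = v \<nu> x" for x
      proof (cases "x \<in> B")
        case True
        have "\<kappa> \<in> normalized_functionals u" "\<kappa>' \<in> normalized_functionals u" using \<kappa> KF by auto
        then have "\<nu> x = ennreal s * ennreal (r \<kappa> x) + ennreal t * ennreal (r \<kappa>' x)"
          unfolding \<nu>_def using r True by metis
        also have "\<dots> = ennreal (s * r \<kappa> x + t * r \<kappa>' x)"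
          using st r0 by (simp add: ennreal_mult)
        finally have "r \<nu> x = s * r \<kappa> x + t * r \<kappa>' x"
          using st r0 by (simp add: r_def[of \<nu>] del: ennreal_plus)
        moreover have "s * (M * r \<phi> x) + t * (M * r \<phi> x) = M * r \<phi> x"
          using st(3) by (simp flip: distrib_right)
        ultimately show ?thesis using True \<kappa> by (simp add: v_def algebra_simps)
      qed (use \<kappa> in \<open>simp add: v_def\<close>)
      ultimately show "(\<lambda>x. s * w x + t * w' x) \<in> v ` K" by auto
    next
      fix w assume "w \<in> v ` K"
      then show "\<exists>x\<in>B. e \<le> w x" using contr by (force simp: not_less)
    qed
    then obtain t where t: "\<And>x. x \<in> B \<Longrightarrow> 0 \<le> t x" "sum t B = 1"
      "\<And>\<kappa>. \<kappa> \<in> K \<Longrightarrow> e \<le> (\<Sum>x\<in>B. t x * v \<kappa> x)" by auto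
    \<comment> \<open>The real weights are replaced by integers \<open>k x\<close>, rounding
      \<open>N * t x\<close> up. This \<open>N\<close> makes the gain \<open>N * e\<close> absorb
      the rounding errors and the contribution \<open>M\<close> of the summand \<open>u\<close> to
      \<open>M * \<phi> y\<close>.\<close>
    obtain N :: nat where N: "(M + M * (\<Sum>x\<in>B. r \<phi> x)) / e \<le> real N"
      using real_arch_simple by blast
    define k where "k x = nat \<lceil>real N * t x\<rceil>" for x
    have k: "real N * t x \<le> real (k x)" "real (k x) \<le> real N * t x + 1" if "x \<in> B" for x
    proof -
      have "0 \<le> real N * t x" using t(1)[OF that] by simp
      then show "real N * t x \<le> real (k x)" "real (k x) \<le> real N * t x + 1"
        unfolding k_def by linarith+
    qed
    \<comment> \<open>The summand \<open>u\<close> makes \<open>y\<close> full;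
      \<open>L \<kappa>\<close> is the real value of \<open>\<kappa>\<close> at
      \<open>y\<close>.\<close>
    define y where "y = u + (\<Sum>x\<in>B. multiple (k x) x)"
    define L where "L \<kappa> = 1 + (\<Sum>x\<in>B. real (k x) * r \<kappa> x)" for \<kappa>
    have L0: "0 \<le> L \<kappa>" for \<kappa> unfolding L_def by (intro add_nonneg_nonneg sum_nonneg) (auto simp: r0)
    have y: "\<kappa> y = ennreal (L \<kappa>)" if "\<kappa> \<in> normalized_functionals u" for \<kappa>
    proof -
      have "\<kappa> \<in> functionals" "\<kappa> u = 1" using that by (auto simp: normalized_functionals_def)
      then have "\<kappa> y = 1 + (\<Sum>x\<in>B. of_nat (k x) * \<kappa> x)"
        by (simp add: y_def functionalsD functional_sum functional_multiple)
      also have "(\<Sum>x\<in>B. of_nat (k x) * \<kappa> x) = (\<Sum>x\<in>B. ennreal (real (k x) * r \<kappa> x))"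
        using r[OF that] by (intro sum.cong) (auto simp: ennreal_mult r0 ennreal_of_nat_eq_real_of_nat)
      also have "\<dots> = ennreal (\<Sum>x\<in>B. real (k x) * r \<kappa> x)"
        by (intro sum_ennreal) (simp add: r0)
      also have "1 + \<dots> = ennreal (L \<kappa>)"
        unfolding L_def by (subst ennreal_plus) (auto intro: sum_nonneg simp: r0)
      finally show ?thesis .
    qed
    \<comment> \<open>The least integer strictly above \<open>M * \<phi> y\<close>. The excess of at
      most 1 is paid for by \<open>\<kappa> u = 1\<close> in \<open>\<kappa> y\<close>.\<close>
    define p where "p = nat \<lfloor>M * L \<phi>\<rfloor> + 1"
    have "0 \<le> M * L \<phi>" using M_pos L0 by simp
    then have p: "M * L \<phi> < real p" "real p \<le> M * L \<phi> + 1" unfolding p_def by linarith+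
    have "L \<phi> \<le> 1 + (\<Sum>x\<in>B. (real N * t x + 1) * r \<phi> x)"
      unfolding L_def using k r0 by (intro add_left_mono sum_mono mult_right_mono) auto
    also have "\<dots> = 1 + real N * (\<Sum>x\<in>B. t x * r \<phi> x) + (\<Sum>x\<in>B. r \<phi> x)"
      by (simp add: sum_distrib_left sum.distrib algebra_simps)
    finally have "M * L \<phi> \<le> M * (1 + real N * (\<Sum>x\<in>B. t x * r \<phi> x) + (\<Sum>x\<in>B. r \<phi> x))"
      using M_pos by (intro mult_left_mono) auto
    moreover have "M + M * (\<Sum>x\<in>B. r \<phi> x) \<le> real N * e" using N e by (simp add: field_simps)
    ultimately have ub: "M * L \<phi> + 1 \<le> 1 + real N * (e + M * (\<Sum>x\<in>B. t x * r \<phi> x))"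
      by (simp add: algebra_simps)
    have "\<kappa> (multiple p u) \<le> \<kappa> y" if "\<kappa> \<in> K" for \<kappa>
    proof -
      have \<kappa>N: "\<kappa> \<in> normalized_functionals u" using that KF by blast
      have "(\<Sum>x\<in>B. t x * v \<kappa> x) = (\<Sum>x\<in>B. t x * r \<kappa> x) - M * (\<Sum>x\<in>B. t x * r \<phi> x)"
        by (simp add: v_def sum_distrib_left sum_subtractf algebra_simps cong: sum.cong)
      then have "e + M * (\<Sum>x\<in>B. t x * r \<phi> x) \<le> (\<Sum>x\<in>B. t x * r \<kappa> x)"
        using t(3)[OF that] by simp
      then have "real N * (e + M * (\<Sum>x\<in>B. t x * r \<phi> x)) \<le> real N * (\<Sum>x\<in>B. t x * r \<kappa> x)"
        by (intro mult_left_mono) auto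
      also have "\<dots> = (\<Sum>x\<in>B. (real N * t x) * r \<kappa> x)" by (simp add: sum_distrib_left mult.assoc)
      also have "\<dots> \<le> (\<Sum>x\<in>B. real (k x) * r \<kappa> x)"
        using k r0 by (intro sum_mono mult_right_mono) auto
      finally have "real p \<le> L \<kappa>" using p ub by (simp add: L_def)
      then show ?thesis
        using y[OF \<kappa>N] normalized_functional_multiple[OF \<kappa>N]
        by (simp add: ennreal_of_nat_eq_real_of_nat ennreal_leI)
    qed
    moreover have "full_element y"
      using u_full by (rule full_element_mono) (simp add: y_def cu_le_add)
    ultimately have "\<phi> (multiple p u) \<le> ennreal M * \<phi> y"
      using comparison \<phi> by (simp add: normalized_functionals_def)
    then have "ennreal (real p) \<le> ennreal (M * L \<phi>)"
      using y[OF \<phi>] normalized_functional_multiple[OF \<phi>] M_pos L0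
      by (simp add: ennreal_of_nat_eq_real_of_nat ennreal_mult)
    then show False using p(1) \<open>0 \<le> M * L \<phi>\<close> by (simp add: ennreal_le_iff)
  qed
  then obtain \<kappa> where \<kappa>: "\<kappa> \<in> K" "\<And>x. x \<in> B \<Longrightarrow> v \<kappa> x < e" by blast
  have "\<kappa> x \<le> ennreal M * \<phi> x + ennreal e" if "x \<in> A" for x
  proof -
    have x: "x \<in> B" using that by (simp add: B_def)
    have "r \<kappa> x \<le> M * r \<phi> x + e" using \<kappa>(2)[OF x] x by (simp add: v_def)
    then have "ennreal (r \<kappa> x) \<le> ennreal (M * r \<phi> x + e)" by (rule ennreal_leI)
    also have "\<dots> = ennreal M * ennreal (r \<phi> x) + ennreal e"
      using M_pos e r0 by (simp add: ennreal_mult)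
    finally show ?thesis using r[OF _ x, of \<kappa>] r[OF \<phi> x] \<kappa>(1) KF by auto
  qed
  then show ?thesis using \<kappa>(1) by blast
qed

subsection \<open>Iterated domination\<close>

text \<open>Both functionals agree on multiples of \<open>u\<close>. If \<open>z\<close> is an
  approximate complement of \<open>y\<close> in \<open>multiple n u\<close>, a smaller value of
  \<open>\<psi>\<close> at \<open>y\<close> would need a larger one at \<open>z\<close>, which
  \<open>le\<close> excludes; the finite \<open>\<phi> z\<close> cancels.\<close>

lemma normalized_functional_eqI:
  fixes u :: "'a::cu_semigroup_O5"
  assumes u_full: "full_element u" and \<phi>: "\<phi> \<in> normalized_functionals u"
    and \<psi>: "\<psi> \<in> normalized_functionals u" and le: "\<And>x. \<psi> x \<le> \<phi> x"
  shows "\<psi> = \<phi>"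
proof
  have F: "\<phi> \<in> functionals" "\<psi> \<in> functionals" using \<phi> \<psi> by (auto simp: normalized_functionals_def)
  fix x
  have "\<phi> x \<le> \<psi> x"
  proof (subst regularization_functional[OF F(1), symmetric], rule regularization_least)
    fix x' assume "x' \<lless> x"
    then obtain y where y: "x' \<lless> y" "y \<lless> x" by (rule way_below_interpolate)
    obtain n where n: "y \<le> multiple n u" using full_element_way_below_multiple[OF u_full y(2)] by blast
    obtain z where z: "x' + z \<le> multiple n u" "multiple n u \<le> y + z" using cu_O5[OF y(1) n] by blast
    have "\<phi> x' + \<phi> z \<le> of_nat n"
      using normalized_functional_bound[OF \<phi> z(1)] by (simp add: functionalsD(3)[OF F(1)])
    also have "of_nat n \<le> \<psi> y + \<psi> z"
      using functionalsD(1)[OF F(2) z(2)] normalized_functional_multiple[OF \<psi>]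
      by (simp add: functionalsD(3)[OF F(2)])
    also have "\<dots> \<le> \<psi> y + \<phi> z" using le by (rule add_left_mono)
    finally have "\<phi> x' + \<phi> z \<le> \<psi> y + \<phi> z" .
    moreover have "\<phi> z \<le> of_nat n"
      using z(1) cu_le_add(1)[of z x'] by (intro normalized_functional_bound[OF \<phi>]) (rule order_trans)
    then have "\<phi> z < top" using of_nat_less_top by (rule order_le_less_trans)
    ultimately have "\<phi> x' \<le> \<psi> y"
      by (auto simp: add.commute[of _ "\<phi> z"] ennreal_add_left_cancel_le)
    also have "\<psi> y \<le> \<psi> x" using way_below_le[OF y(2)] by (rule functionalsD(1)[OF F(2)])
    finally show "\<phi> x' \<le> \<psi> x" .
  qed
  with le show "\<psi> x = \<phi> x" by (rule antisym)
qed

text \<open>\<open>\<phi>'\<close> is the regularized difference divided by its value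
  \<open>1 - \<theta>\<close> at the compact element \<open>u\<close>. Regularization may lower the
  difference elsewhere, so only an inequality results.\<close>

lemma normalized_functional_remainder:
  fixes u :: "'a::cu_semigroup_O5"
  assumes u_compact: "compact_element u" and \<phi>: "\<phi> \<in> normalized_functionals u"
    and \<kappa>: "\<kappa> \<in> normalized_functionals u" and \<theta>: "0 < \<theta>" "\<theta> < 1"
    and le: "\<And>x. ennreal \<theta> * \<kappa> x \<le> \<phi> x"
  shows "\<exists>\<phi>'\<in>normalized_functionals u. \<forall>x. ennreal \<theta> * \<kappa> x + ennreal (1 - \<theta>) * \<phi>' x \<le> \<phi> x"
proof -
  have F: "\<phi> \<in> functionals" "(\<lambda>x. ennreal \<theta> * \<kappa> x) \<in> functionals"
    and u: "\<phi> u = 1" "\<kappa> u = 1"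
    using \<phi> \<kappa> functionals_scale by (auto simp: normalized_functionals_def)
  define \<nu> where "\<nu> = regularization (\<lambda>x. \<phi> x - ennreal \<theta> * \<kappa> x)"
  note diff = functional_difference[OF F le]
  have "\<nu> u = 1 - ennreal \<theta>"
    using regularization_compact[OF diff(1) u_compact] by (simp add: \<nu>_def u)
  also have "\<dots> = ennreal (1 - \<theta>)" using \<theta> by (simp add: ennreal_minus flip: ennreal_1)
  finally have \<nu>u: "\<nu> u = ennreal (1 - \<theta>)" .
  have inv: "ennreal (1 - \<theta>) * ennreal (1 / (1 - \<theta>)) = 1"
    using \<theta> by (simp flip: ennreal_mult)
  define \<phi>' where "\<phi>' = (\<lambda>x. ennreal (1 / (1 - \<theta>)) * \<nu> x)"
  have "\<phi>' \<in> normalized_functionals u"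
    using functionals_scale[OF diff(2)] \<nu>u inv
    by (simp add: normalized_functionals_def \<phi>'_def \<nu>_def[symmetric] mult.commute[of "ennreal (1 / (1 - \<theta>))" "ennreal (1 - \<theta>)"])
  moreover have "ennreal \<theta> * \<kappa> x + ennreal (1 - \<theta>) * \<phi>' x \<le> \<phi> x" for x
  proof -
    have "ennreal \<theta> * \<kappa> x + ennreal (1 - \<theta>) * \<phi>' x = ennreal \<theta> * \<kappa> x + \<nu> x"
      using inv by (simp add: \<phi>'_def flip: mult.assoc)
    also have "\<dots> \<le> ennreal \<theta> * \<kappa> x + (\<phi> x - ennreal \<theta> * \<kappa> x)"
      unfolding \<nu>_def using diff(1) by (intro add_left_mono regularization_le)
    also have "\<dots> = \<phi> x" using ennreal_ineq_diff_add[OF le] by simp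
    finally show ?thesis .
  qed
  ultimately show ?thesis by blast
qed

text \<open>The remainder of \<open>\<phi>\<close> after removing \<open>\<theta> * \<kappa>\<close>
  is treated by induction, and the two elements of \<open>K\<close> are merged by convexity. The
  exponent \<open>Suc n\<close> keeps the mass \<open>s\<close> positive, as the convex combination
  requires.\<close>

lemma convex_domination_iterate:
  fixes u :: "'a::cu_semigroup_O5"
  assumes u_compact: "compact_element u"
    and KF: "K \<subseteq> normalized_functionals u"
    and K_convex: "convex_functionals K"
    and \<theta>: "0 < \<theta>" "\<theta> < 1"
    and dom: "\<And>\<phi>. \<phi> \<in> normalized_functionals u \<Longrightarrow> \<exists>\<kappa>\<in>K. \<forall>x. ennreal \<theta> * \<kappa> x \<le> \<phi> x"
    and \<phi>: "\<phi> \<in> normalized_functionals u"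
  shows "\<exists>\<kappa>\<in>K. \<forall>x. ennreal (1 - (1 - \<theta>) ^ Suc n) * \<kappa> x \<le> \<phi> x"
  using \<phi>
proof (induction n arbitrary: \<phi>)
  case 0
  then show ?case using dom by simp
next
  case (Suc n)
  obtain \<kappa> where \<kappa>: "\<kappa> \<in> K" "\<And>x. ennreal \<theta> * \<kappa> x \<le> \<phi> x" using dom[OF Suc.prems] by blast
  obtain \<phi>' where \<phi>': "\<phi>' \<in> normalized_functionals u"
    "\<And>x. ennreal \<theta> * \<kappa> x + ennreal (1 - \<theta>) * \<phi>' x \<le> \<phi> x"
    using normalized_functional_remainder[OF u_compact Suc.prems _ \<theta> \<kappa>(2)] \<kappa>(1) KF by blast
  define s where "s = 1 - (1 - \<theta>) ^ Suc n"
  obtain \<kappa>' where \<kappa>': "\<kappa>' \<in> K" "\<And>x. ennreal s * \<kappa>' x \<le> \<phi>' x"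
    using Suc.IH[OF \<phi>'(1)] unfolding s_def by blast
  have "(1 - \<theta>) ^ Suc n < 1" using \<theta> by (intro power_Suc_less_one) auto
  then have s: "0 < s" by (simp add: s_def)
  \<comment> \<open>The total mass removed; the missing mass satisfies
    \<open>1 - q = (1 - \<theta>) * (1 - s)\<close>.\<close>
  define q where "q = \<theta> + (1 - \<theta>) * s"
  have q: "0 < q" "q = 1 - (1 - \<theta>) ^ Suc (Suc n)"
    using s \<theta> by (simp add: q_def add_pos_pos) (simp add: q_def s_def algebra_simps)
  define \<nu> where "\<nu> = (\<lambda>x. ennreal (\<theta> / q) * \<kappa> x + ennreal ((1 - \<theta>) * s / q) * \<kappa>' x)"
  have "\<theta> / q + (1 - \<theta>) * s / q = 1"
    using q(1) by (simp add: q_def flip: add_divide_distrib)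
  then have "\<nu> \<in> K"
    using K_convex \<kappa>(1) \<kappa>'(1) \<theta> s q(1) unfolding convex_functionals_def \<nu>_def by simp
  moreover have "ennreal q * \<nu> x \<le> \<phi> x" for x
  proof -
    have "ennreal q * \<nu> x = ennreal \<theta> * \<kappa> x + ennreal (1 - \<theta>) * (ennreal s * \<kappa>' x)"
      using q(1) \<theta> s by (simp add: \<nu>_def distrib_left flip: mult.assoc ennreal_mult)
    also have "\<dots> \<le> ennreal \<theta> * \<kappa> x + ennreal (1 - \<theta>) * \<phi>' x"
      using \<kappa>'(2) by (intro add_left_mono mult_left_mono) auto
    also have "\<dots> \<le> \<phi> x" by (rule \<phi>'(2))
    finally show ?thesis .
  qed
  ultimately show ?case unfolding q(2)[symmetric] by blast
qed

theorem theoremC1: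
  fixes u :: "'a::cu_semigroup_O5"
    and K :: "('a \<Rightarrow> ennreal) set"
    and M :: real
  assumes u_full: "full_element u"
    and u_compact: "compact_element u"
    and K_closed: "closedin (subtopology functional_topology (normalized_functionals u)) K"
    and K_convex: "convex_functionals K"
    and M_pos: "0 < M"
    and comparison: "\<And>x y :: 'a. full_element y \<Longrightarrow> (\<forall>\<phi>\<in>K. hat x \<phi> \<le> hat y \<phi>) \<Longrightarrow>
          (\<forall>\<phi>\<in>functionals. hat x \<phi> \<le> ennreal M * hat y \<phi>)"
  shows "K = normalized_functionals u"
proof
  show KF: "K \<subseteq> normalized_functionals u" using closedin_subset[OF K_closed] by auto
  \<comment> \<open>\<open>M + 1\<close> in place of \<open>M\<close> guarantees
    \<open>\<theta> < 1\<close>, so that division by \<open>1 - \<theta>\<close> is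
    possible.\<close>
  define \<theta> where "\<theta> = 1 / (M + 1)"
  have \<theta>: "0 < \<theta>" "\<theta> < 1" using M_pos by (auto simp: \<theta>_def)
  have dom: "\<exists>\<kappa>\<in>K. \<forall>x. ennreal \<theta> * \<kappa> x \<le> \<phi> x" if \<phi>: "\<phi> \<in> normalized_functionals u" for \<phi>
  proof -
    have "mono \<phi>" using \<phi> by (simp add: normalized_functionals_def functionals_def)
    then have "mono (\<lambda>x. ennreal M * \<phi> x)" by (simp add: mono_def mult_left_mono)
    then obtain \<kappa> where \<kappa>: "\<kappa> \<in> K" "\<And>x. \<kappa> x \<le> ennreal M * \<phi> x"
      using closed_set_dominated_functional[OF u_full u_compact K_closed, of "\<lambda>x. ennreal M * \<phi> x"]
        finite_domination_of_comparison[OF u_full KF K_convex M_pos comparison[unfolded hat_def] \<phi>]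
      by blast
    have "ennreal \<theta> * \<kappa> x \<le> \<phi> x" for x
    proof -
      have "ennreal \<theta> * \<kappa> x \<le> ennreal \<theta> * (ennreal M * \<phi> x)"
        using \<kappa>(2) by (intro mult_left_mono) auto
      also have "\<dots> = ennreal (\<theta> * M) * \<phi> x"
        using \<theta> M_pos by (simp add: ennreal_mult mult.assoc)
      also have "\<dots> \<le> 1 * \<phi> x"
        using M_pos by (intro mult_right_mono) (auto simp: \<theta>_def simp flip: ennreal_1 intro!: ennreal_leI)
      finally show ?thesis by simp
    qed
    then show ?thesis using \<kappa>(1) by blast
  qed
  show "normalized_functionals u \<subseteq> K"
  proof
    fix \<phi> assume \<phi>: "\<phi> \<in> normalized_functionals u"
    have "\<exists>\<kappa>\<in>K. \<forall>x. \<kappa> x \<le> \<phi> x"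
    proof (rule closed_set_dominated_functional[OF u_full u_compact K_closed])
      show "mono \<phi>" using \<phi> by (simp add: normalized_functionals_def functionals_def)
      fix A :: "'a set" and e :: real
      assume A: "finite A" "\<forall>x\<in>A. \<exists>n. x \<le> multiple n u" and e: "0 < e"
      obtain f where f: "\<And>x. x \<in> A \<Longrightarrow> x \<le> multiple (f x) u" using A(2) by metis
      \<comment> \<open>A common bound for the values at elements of \<open>A\<close> of all
        functionals in \<open>K\<close>, fixed before \<open>n\<close> and \<open>\<kappa>\<close>
        are chosen.\<close>
      define m where "m = (\<Sum>x\<in>A. f x)"
      have m: "x \<le> multiple m u" if "x \<in> A" for x
      proof -
        have "f x \<le> m" unfolding m_def using A(1) that by (intro member_le_sum) auto
        then show ?thesis using f[OF that] incseq_multiple[of u] by (meson incseqD order_trans)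
      qed
      \<comment> \<open>The missing mass \<open>d\<close> contributes at most
        \<open>d * m \<le> e\<close>; \<open>real m + 1\<close> avoids division by zero.\<close>
      obtain n where n: "(1 - \<theta>) ^ n < e / (real m + 1)"
        using real_arch_pow_inv[of "e / (real m + 1)" "1 - \<theta>"] e \<theta> by auto
      define d where "d = (1 - \<theta>) ^ Suc n"
      have d: "0 \<le> d" "d \<le> 1" using \<theta> by (auto simp: d_def intro!: mult_le_one power_le_one)
      have "d \<le> (1 - \<theta>) ^ n" using \<theta> by (simp add: d_def mult_left_le_one_le)
      then have "d \<le> e / (real m + 1)" using n by simp
      then have "d * (real m + 1) \<le> e" by (simp add: pos_le_divide_eq)
      then have dm: "d * real m \<le> e" using d by (simp add: algebra_simps)
      obtain \<kappa> where \<kappa>: "\<kappa> \<in> K" "\<And>x. ennreal (1 - d) * \<kappa> x \<le> \<phi> x"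
        using convex_domination_iterate[OF u_compact KF K_convex \<theta> dom \<phi>] unfolding d_def by blast
      have "\<kappa> x \<le> \<phi> x + ennreal e" if "x \<in> A" for x
      proof -
        have "\<kappa> x \<le> of_nat m"
          using \<kappa>(1) KF m[OF that] by (intro normalized_functional_bound) auto
        then have "ennreal d * \<kappa> x \<le> ennreal d * of_nat m" by (intro mult_left_mono) auto
        also have "\<dots> = ennreal (d * real m)" using d by (simp add: ennreal_mult ennreal_of_nat_eq_real_of_nat)
        also have "\<dots> \<le> ennreal e" using dm by (rule ennreal_leI)
        finally have "ennreal (1 - d) * \<kappa> x + ennreal d * \<kappa> x \<le> \<phi> x + ennreal e"
          using \<kappa>(2) by (intro add_mono)
        moreover have "ennreal (1 - d) * \<kappa> x + ennreal d * \<kappa> x = \<kappa> x"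
          using d by (simp flip: distrib_right ennreal_plus)
        ultimately show ?thesis by simp
      qed
      then show "\<exists>\<kappa>\<in>K. \<forall>x\<in>A. \<kappa> x \<le> \<phi> x + ennreal e" using \<kappa>(1) by blast
    qed
    then obtain \<kappa> where "\<kappa> \<in> K" "\<And>x. \<kappa> x \<le> \<phi> x" by blast
    then show "\<phi> \<in> K" using normalized_functional_eqI[OF u_full \<phi>] KF by blast
  qed
qed

end
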